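(* Let the global unique solvability assumption for the collocation system (stated in the context) hold, suppose that the system $\bm y'=\bm f(\bm y)$ is logarithmically dissipative with constant $\nu\le0$, and assume algebraic stability, that is, with $b_j=Q_{M,j}$, $\bm b=[b_0,\dots,b_M]^\top$ and $Q=(Q_{m,j})_{m,j=0}^M$: $b_j\ge0$ for each $j=0,\dots,M$ and the matrix $\operatorname{diag}(\bm b)\,Q+Q^\top\operatorname{diag}(\bm b)-\bm b\bm b^\top$ is positive semi-definite. Let $N_k\le M$. Then there exists a constant $C>0$, independent of the stepsize $h$, such that for any $\bm y,\bm z\in\mathbb{R}^N_+$, $$\operatorname{d}\big(\bm\Phi^{h,N_k}(\bm y),\bm\Phi^{h,N_k}(\bm z)\big)\le\operatorname{d}(\bm y,\bm z)+C\,h^{N_k+2}.$$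
   Context: Let $\mathbb{R}^N_+=\{\bm\eta\in\mathbb{R}^N:\eta_i>0\ \forall i\}$. Consider $\bm y'(t)=\bm f(\bm y(t))$, $t\in[0,T]$, $\bm y(0)=\bm y_0\in\mathbb{R}^N_+$, where $\bm f=[f_1,\dots,f_N]^\top$ is a sufficiently smooth $\mathbb{R}^N$-valued function defined on an open set containing $\mathbb{R}^N_+$. Standing assumption: $\mathbb{R}^N_+$ is forward invariant under the flow. Let $M,N_k\ge0$ be integers, $h>0$ the stepsize, and let $0\le\tau_0<\tau_1<\dots<\tau_M=1$ be quadrature nodes with Lagrange basis polynomials $\ell_0,\dots,\ell_M$ (of degree at most $M$). Set $Q_{m,j}=\int_0^{\tau_m}\ell_j(\tau)\,d\tau$ for $m,j=0,\dots,M$. One step of the SPIDeC scheme from $\bm y^n\in\mathbb{R}^N_+$ is, for $i=1,\dots,N$, $m=0,\dots,M$: $$y^{n,m}_{i(0)}=y_i^n\exp\Big(h\tau_m\frac{f_i(\bm y^n)}{y_i^n}\Big),\qquad y^{n,m}_{i(k)}=y_i^n\exp\Big(h\sum_{j=0}^M Q_{m,j}\frac{f_i(\bm y^{n,j}_{(k-1)})}{y^{n,j}_{i(k-1)}}\Big),\quad k=1,\dots,N_k.$$ The induced numerical map is $\bm\Phi^{h,N_k}:\mathbb{R}^N_+\to\mathbb{R}^N_+$, $\Phi_i^{h,N_k}(\bm y^n)=y^{n,M}_{i(N_k)}$. Global unique solvability assumption: for each $h>0$ and each $\bm y^n\in\mathbb{R}^N_+$ the collocation system $$y_i^{n,m}=y_i^n\exp\Big(h\sum_{j=0}^M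 Q_{m,j}\frac{f_i(\bm y^{n,j})}{y_i^{n,j}}\Big),\qquad i=1,\dots,N,\ m=0,\dots,M,$$ admits a unique solution $[\tilde{\bm y}^{n,0},\dots,\tilde{\bm y}^{n,M}]\in\mathbb{R}^{N\times(M+1)}_{>0}$ (all entries positive). Logarithmic dissipativity: with $\operatorname{Exp}(\bm u)=[e^{u_1},\dots,e^{u_N}]^\top$, define $\bm G:\mathbb{R}^N\to\mathbb{R}^N$ by $G_i(\bm u)=f_i(\operatorname{Exp}(\bm u))/e^{u_i}$. The system is logarithmically dissipative with constant $\nu\in\mathbb{R}$ if $\langle\bm G(\bm u)-\bm G(\bm v),\bm u-\bm v\rangle\le\nu\|\bm u-\bm v\|^2$ for all $\bm u,\bm v\in\mathbb{R}^N$ (Euclidean inner product and norm). Log-Euclidean metric on $\mathbb{R}^N_+$: $\operatorname{d}(\bm y,\bm z)=\|\operatorname{Log}(\bm y)-\operatorname{Log}(\bm z)\|$, with $\operatorname{Log}(\bm v)=[\log v_1,\dots,\log v_N]^\top$.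
   Formalization: C is uniform only for y,z in a compact subset of R^N_+ and 0<h≤T (T>0 arbitrary), so it may depend on that set and on T; with C uniform over all of R^N_+ the claim fails, e.g. f(y)=-y(ln y)^3, M=N_k=0, τ_0=1. *)

theory Defs
  imports "HOL-Analysis.Analysis"
begin

section \<open>The differential system\<close>

definition pos_orthant :: "(real ^ 'n) set" where
  "pos_orthant = {y. \<forall>i. 0 < y $ i}"

definition Exp_vec :: "real ^ 'n \<Rightarrow> real ^ 'n" where
  "Exp_vec u = (\<chi> i. exp (u $ i))"

definition Log_vec :: "real ^ 'n \<Rightarrow> real ^ 'n" where
  "Log_vec y = (\<chi> i. ln (y $ i))"

definition log_euclidean_dist :: "real ^ 'n \<Rightarrow> real ^ 'n \<Rightarrow> real" where
  "log_euclidean_dist y z = norm (Log_vec y - Log_vec z)"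

definition C1_on :: "(real ^ 'n \<Rightarrow> real ^ 'n) \<Rightarrow> (real ^ 'n) set \<Rightarrow> bool" where
  "C1_on f D \<longleftrightarrow>
    (\<exists>f' :: real ^ 'n \<Rightarrow> ((real ^ 'n) \<Rightarrow>\<^sub>L (real ^ 'n)).
      (\<forall>x\<in>D. (f has_derivative blinfun_apply (f' x)) (at x)) \<and> continuous_on D f')"

text \<open>
  Every solution of the autonomous system \<open>y' = f y\<close> that lives in the domain \<open>D\<close> of the vector
  field and starts in \<open>S\<close> stays in \<open>S\<close>; existence of solutions is not part of the notion.
\<close>

definition forward_invariant ::
    "(real ^ 'n \<Rightarrow> real ^ 'n) \<Rightarrow> (real ^ 'n) set \<Rightarrow> (real ^ 'n) set \<Rightarrow> bool" where
  "forward_invariant f D S \<longleftrightarrow>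
    (\<forall>y t1. 0 \<le> t1 \<longrightarrow> y 0 \<in> S \<longrightarrow>
      (\<forall>t\<in>{0..t1}. y t \<in> D \<and> (y has_vector_derivative f (y t)) (at t within {0..t1})) \<longrightarrow>
      (\<forall>t\<in>{0..t1}. y t \<in> S))"

definition log_field :: "(real ^ 'n \<Rightarrow> real ^ 'n) \<Rightarrow> real ^ 'n \<Rightarrow> real ^ 'n" where
  "log_field f u = (\<chi> i. f (Exp_vec u) $ i / exp (u $ i))"

definition log_dissipative :: "(real ^ 'n \<Rightarrow> real ^ 'n) \<Rightarrow> real \<Rightarrow> bool" where
  "log_dissipative f \<nu> \<longleftrightarrow>
    (\<forall>u v. (log_field f u - log_field f v) \<bullet> (u - v) \<le> \<nu> * (norm (u - v))\<^sup>2)"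

section \<open>Quadrature\<close>

text \<open>
  Vectors and matrices indexed by the stages \<open>0, \<dots>, M\<close> are functions on \<open>nat\<close>; only their values
  at indices up to \<open>M\<close> are ever used.
\<close>

definition quadrature_nodes :: "nat \<Rightarrow> (nat \<Rightarrow> real) \<Rightarrow> bool" where
  "quadrature_nodes M \<tau> \<longleftrightarrow> 0 \<le> \<tau> 0 \<and> strict_mono_on {..M} \<tau> \<and> \<tau> M = 1"

definition lagrange_basis :: "nat \<Rightarrow> (nat \<Rightarrow> real) \<Rightarrow> nat \<Rightarrow> real \<Rightarrow> real" where
  "lagrange_basis M \<tau> j x = (\<Prod>i\<in>{..M} - {j}. (x - \<tau> i) / (\<tau> j - \<tau> i))"

definition quad_Q :: "nat \<Rightarrow> (nat \<Rightarrow> real) \<Rightarrow> nat \<Rightarrow> nat \<Rightarrow> real" where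
  "quad_Q M \<tau> m j = integral {0..\<tau> m} (lagrange_basis M \<tau> j)"

definition quad_b :: "nat \<Rightarrow> (nat \<Rightarrow> real) \<Rightarrow> nat \<Rightarrow> real" where
  "quad_b M \<tau> j = quad_Q M \<tau> M j"

definition positive_semidef :: "nat \<Rightarrow> (nat \<Rightarrow> nat \<Rightarrow> real) \<Rightarrow> bool" where
  "positive_semidef M A \<longleftrightarrow>
    (\<forall>i\<le>M. \<forall>j\<le>M. A i j = A j i) \<and>
    (\<forall>\<xi> :: nat \<Rightarrow> real. 0 \<le> (\<Sum>i\<le>M. \<Sum>j\<le>M. \<xi> i * A i j * \<xi> j))"

text \<open>
  The matrix below is \<open>diag(b) Q + Q\<^sup>T diag(b) - b b\<^sup>T\<close> written entrywise.
\<close>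

definition algebraically_stable :: "nat \<Rightarrow> (nat \<Rightarrow> real) \<Rightarrow> bool" where
  "algebraically_stable M \<tau> \<longleftrightarrow>
    (\<forall>j\<le>M. 0 \<le> quad_b M \<tau> j) \<and>
    positive_semidef M (\<lambda>i j. quad_b M \<tau> i * quad_Q M \<tau> i j + quad_Q M \<tau> j i * quad_b M \<tau> j
                              - quad_b M \<tau> i * quad_b M \<tau> j)"

section \<open>The scheme and the underlying collocation method\<close>

text \<open>
  \<open>spidec_stage f M \<tau> h y k m\<close> is the stage with node index \<open>m\<close> after \<open>k\<close> sweeps.
\<close>

primrec spidec_stage ::
    "(real ^ 'n \<Rightarrow> real ^ 'n) \<Rightarrow> nat \<Rightarrow> (nat \<Rightarrow> real) \<Rightarrow> real \<Rightarrow> real ^ 'n \<Rightarrow> nat \<Rightarrow> nat \<Rightarrow> real ^ 'n"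
  where
  "spidec_stage f M \<tau> h y 0 = (\<lambda>m. \<chi> i. y $ i * exp (h * \<tau> m * (f y $ i / y $ i)))"
| "spidec_stage f M \<tau> h y (Suc k) = (\<lambda>m. \<chi> i. y $ i *
     exp (h * (\<Sum>j\<le>M. quad_Q M \<tau> m j *
       (f (spidec_stage f M \<tau> h y k j) $ i / spidec_stage f M \<tau> h y k j $ i))))"

definition spidec_map ::
    "(real ^ 'n \<Rightarrow> real ^ 'n) \<Rightarrow> nat \<Rightarrow> (nat \<Rightarrow> real) \<Rightarrow> nat \<Rightarrow> real \<Rightarrow> real ^ 'n \<Rightarrow> real ^ 'n" where
  "spidec_map f M \<tau> Nk h y = spidec_stage f M \<tau> h y Nk M"

definition collocation_system ::
    "(real ^ 'n \<Rightarrow> real ^ 'n) \<Rightarrow> nat \<Rightarrow> (nat \<Rightarrow> real) \<Rightarrow> real \<Rightarrow> real ^ 'n \<Rightarrow> (nat \<Rightarrow> real ^ 'n) \<Rightarrow> bool"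
  where
  "collocation_system f M \<tau> h y Y \<longleftrightarrow>
    (\<forall>m\<le>M. \<forall>i. Y m $ i = y $ i *
       exp (h * (\<Sum>j\<le>M. quad_Q M \<tau> m j * (f (Y j) $ i / Y j $ i))))"

text \<open>
  The extensional function space makes uniqueness refer to the stages \<open>0, \<dots>, M\<close> only.
\<close>

definition globally_uniquely_solvable ::
    "(real ^ 'n \<Rightarrow> real ^ 'n) \<Rightarrow> nat \<Rightarrow> (nat \<Rightarrow> real) \<Rightarrow> bool" where
  "globally_uniquely_solvable f M \<tau> \<longleftrightarrow>
    (\<forall>h>0. \<forall>y\<in>pos_orthant.
      \<exists>!Y. Y \<in> {..M} \<rightarrow>\<^sub>E pos_orthant \<and> collocation_system f M \<tau> h y Y)"

end

theory Submission
  imports Defs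
begin

text \<open>
  In the logarithmic variables \<open>u = Log y\<close> the scheme is a plain Picard iteration for the collocation
  equations \<open>U\<^sub>m = u + h \<Sum>\<^sub>j Q\<^sub>m\<^sub>j G(U\<^sub>j)\<close>, where \<open>G\<close> is \<open>log_field f\<close>, and the log-Euclidean distance becomes
  the Euclidean one (\<open>Log_spidec_stage\<close>). As the rows of \<open>Q\<close> sum to the nodes (\<open>sum_quad_Q\<close>), already
  the initial stages are a Picard iterate, namely the first one if one starts from the constant
  stages \<open>U\<^sub>m = u\<close>. So \<open>k\<close> sweeps amount to \<open>k + 1\<close> Picard steps.

  The start is wrong by \<open>O(h)\<close>, and each Picard step gains a factor \<open>h\<close>. Thus the \<open>n\<close>-th iterate solves
  the collocation equations up to a defect \<open>O(h\<^sup>n\<^sup>+\<^sup>1)\<close>, uniformly for bounded \<open>u\<close> and \<open>h\<close>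
  (\<open>picard_increment\<close>). The classical identity by which algebraic stability and dissipativity make
  a Runge--Kutta method nonexpansive still holds for approximate stages, with an extra term that
  pairs the defects with the differences of the field values (\<open>algebraic_stability_estimate\<close>).
  These differences are in turn \<open>O(\<parallel>u - v\<parallel>)\<close>, because the Picard iterates are Lipschitz in the initial
  value (\<open>picard_lipschitz\<close>). The squared distance after the step is therefore at most
  \<open>\<parallel>u - v\<parallel>\<^sup>2 + O(h\<^sup>n\<^sup>+\<^sup>2) \<parallel>u - v\<parallel>\<close>, and completing the square gives \<open>\<parallel>u - v\<parallel> + O(h\<^sup>n\<^sup>+\<^sup>1)\<close> for the distance
  (\<open>picard_almost_nonexpansive\<close>). With \<open>n = k + 1\<close> this is the claim. In this way the iterates are
  compared with each other directly and not through the exact collocation solutions, for which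
  bounds uniform in the stepsize would be needed.
\<close>

section \<open>Picard iteration for the stage equations\<close>

primrec picard ::
    "('a::real_vector \<Rightarrow> 'a) \<Rightarrow> nat \<Rightarrow> (nat \<Rightarrow> nat \<Rightarrow> real) \<Rightarrow> real \<Rightarrow> 'a \<Rightarrow> nat \<Rightarrow> nat \<Rightarrow> 'a" where
  "picard G M A h u 0 = (\<lambda>m. u)"
| "picard G M A h u (Suc k) =
     (\<lambda>m. u + h *\<^sub>R (\<Sum>j\<le>M. A m j *\<^sub>R G (picard G M A h u k j)))"

definition lipschitz_on_balls :: "('a::real_normed_vector \<Rightarrow> 'a) \<Rightarrow> bool" where
  "lipschitz_on_balls G \<longleftrightarrow>
     (\<forall>R. \<exists>L\<ge>0. \<forall>u v. norm u \<le> R \<longrightarrow> norm v \<le> R \<longrightarrow> norm (G u - G v) \<le> L * norm (u - v))"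

lemma norm_weighted_sum_le:
  fixes F :: "nat \<Rightarrow> 'a::real_normed_vector"
  assumes "\<And>j. j \<le> M \<Longrightarrow> norm (F j) \<le> \<phi>" "(\<Sum>j\<le>M. \<bar>a j\<bar>) \<le> q" "0 \<le> \<phi>" "0 \<le> h"
  shows "norm (h *\<^sub>R (\<Sum>j\<le>M. a j *\<^sub>R F j)) \<le> h * q * \<phi>"
proof -
  have "norm (\<Sum>j\<le>M. a j *\<^sub>R F j) \<le> (\<Sum>j\<le>M. \<bar>a j\<bar> * \<phi>)"
    by (rule sum_norm_le) (auto intro!: mult_left_mono assms)
  also have "\<dots> \<le> q * \<phi>"
    using assms(2,3) by (simp add: sum_distrib_right[symmetric] mult_right_mono)
  finally show ?thesis
    using assms(4) by (simp add: mult.assoc mult_left_mono)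
qed

lemma lipschitz_on_balls_imp_bounded:
  assumes "lipschitz_on_balls G"
  shows "\<exists>g\<ge>0. \<forall>u. norm u \<le> R \<longrightarrow> norm (G u) \<le> g"
proof (cases "0 \<le> R")
  case True
  obtain L where L: "L \<ge> 0"
    "\<And>u v. norm u \<le> R \<Longrightarrow> norm v \<le> R \<Longrightarrow> norm (G u - G v) \<le> L * norm (u - v)"
    using assms unfolding lipschitz_on_balls_def by metis
  have "norm (G u) \<le> norm (G 0) + L * R" if "norm u \<le> R" for u
  proof -
    have "norm (G u - G 0) \<le> L * norm u"
      using L(2)[of u 0] that True by simp
    also have "\<dots> \<le> L * R"
      using that L(1) by (rule mult_left_mono)
    finally show ?thesis
      using norm_triangle_sub[of "G u" "G 0"] by linarith
  qed
  moreover have "norm (G 0) + L * R \<ge> 0"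
    using L(1) True by simp
  ultimately show ?thesis by blast
next
  case False
  then show ?thesis by (meson norm_ge_zero order_trans order_refl)
qed

text \<open>
  Each Picard step maps bounded sets of stages to bounded sets, so a fixed number of iterates stays
  in one ball for all stepsizes up to \<open>T\<close>. On this ball a single Lipschitz constant can be used.
\<close>

lemma picard_bounded:
  fixes G :: "'a::real_normed_vector \<Rightarrow> 'a"
  assumes G: "lipschitz_on_balls G" and "bounded B"
    and q: "\<And>m. m \<le> M \<Longrightarrow> (\<Sum>j\<le>M. \<bar>A m j\<bar>) \<le> q" "0 \<le> q"
  shows "\<exists>R\<ge>0. \<forall>k\<le>n. \<forall>h u m. 0 \<le> h \<longrightarrow> h \<le> T \<longrightarrow> u \<in> B \<longrightarrow> m \<le> M \<longrightarrow>
           norm (picard G M A h u k m) \<le> R"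
proof (induction n)
  case 0
  obtain R where "R > 0" "\<forall>u\<in>B. norm u \<le> R"
    using \<open>bounded B\<close> unfolding bounded_pos by blast
  then show ?case by (intro exI[of _ R]) auto
next
  case (Suc n)
  then obtain R where R: "R \<ge> 0"
    "\<And>k h u m. k \<le> n \<Longrightarrow> 0 \<le> h \<Longrightarrow> h \<le> T \<Longrightarrow> u \<in> B \<Longrightarrow> m \<le> M \<Longrightarrow> norm (picard G M A h u k m) \<le> R"
    by blast
  obtain S where S: "S > 0" "\<forall>u\<in>B. norm u \<le> S"
    using \<open>bounded B\<close> unfolding bounded_pos by blast
  obtain g where g: "g \<ge> 0" "\<And>u. norm u \<le> R \<Longrightarrow> norm (G u) \<le> g"
    using lipschitz_on_balls_imp_bounded[OF G] by metis
  have new: "norm (picard G M A h u (Suc n) m) \<le> S + T * q * g"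
    if "0 \<le> h" "h \<le> T" "u \<in> B" "m \<le> M" for h u m
  proof -
    have "norm (h *\<^sub>R (\<Sum>j\<le>M. A m j *\<^sub>R G (picard G M A h u n j))) \<le> h * q * g"
      using that q g R(2) by (intro norm_weighted_sum_le) auto
    also have "\<dots> \<le> T * q * g"
      using that q g by (intro mult_right_mono) auto
    finally have *: "norm (h *\<^sub>R (\<Sum>j\<le>M. A m j *\<^sub>R G (picard G M A h u n j))) \<le> T * q * g" .
    show ?thesis
      unfolding picard.simps(2) using S(2) that(3) by (intro norm_triangle_mono[OF _ *]) auto
  qed
  show ?case
    using R new by (intro exI[of _ "max R (S + T * q * g)"])
      (auto simp: le_Suc_eq le_max_iff_disj simp del: picard.simps)
qed

lemma picard_lipschitz:
  fixes G :: "'a::real_normed_vector \<Rightarrow> 'a"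
  assumes L: "0 \<le> L"
      "\<And>u v. norm u \<le> R \<Longrightarrow> norm v \<le> R \<Longrightarrow> norm (G u - G v) \<le> L * norm (u - v)"
    and q: "\<And>m. m \<le> M \<Longrightarrow> (\<Sum>j\<le>M. \<bar>A m j\<bar>) \<le> q" "0 \<le> q" and "0 \<le> h"
    and u: "\<And>k m. k < n \<Longrightarrow> m \<le> M \<Longrightarrow> norm (picard G M A h u k m) \<le> R"
    and v: "\<And>k m. k < n \<Longrightarrow> m \<le> M \<Longrightarrow> norm (picard G M A h v k m) \<le> R"
    and "m \<le> M"
  shows "norm (picard G M A h u n m - picard G M A h v n m) \<le> (1 + h * q * L) ^ n * norm (u - v)"
  using u v \<open>m \<le> M\<close>
proof (induction n arbitrary: m)
  case (Suc n)
  let ?x = "h * q * L" and ?d = "norm (u - v)"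
  let ?F = "\<lambda>j. G (picard G M A h u n j) - G (picard G M A h v n j)"
  have x: "0 \<le> ?x" using L q \<open>0 \<le> h\<close> by simp
  have "norm (?F j) \<le> L * ((1 + ?x) ^ n * ?d)" if "j \<le> M" for j
  proof -
    have "norm (?F j) \<le> L * norm (picard G M A h u n j - picard G M A h v n j)"
      using Suc.prems that by (intro L(2)) auto
    also have "\<dots> \<le> L * ((1 + ?x) ^ n * ?d)"
      using Suc that L(1) by (intro mult_left_mono Suc.IH) auto
    finally show ?thesis .
  qed
  then have "norm (h *\<^sub>R (\<Sum>j\<le>M. A m j *\<^sub>R ?F j)) \<le> h * q * (L * ((1 + ?x) ^ n * ?d))"
    using Suc.prems q L(1) x \<open>0 \<le> h\<close> by (intro norm_weighted_sum_le) auto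
  then have 1: "norm (h *\<^sub>R (\<Sum>j\<le>M. A m j *\<^sub>R ?F j)) \<le> ?x * (1 + ?x) ^ n * ?d"
    by (simp add: mult.assoc)
  have 2: "?d \<le> (1 + ?x) ^ n * ?d"
    using x mult_right_mono[of 1 "(1 + ?x) ^ n" ?d] by (simp add: one_le_power)
  have eq: "picard G M A h u (Suc n) m - picard G M A h v (Suc n) m
      = (u - v) + h *\<^sub>R (\<Sum>j\<le>M. A m j *\<^sub>R ?F j)"
    by (simp add: algebra_simps sum_subtractf)
  have "norm (picard G M A h u (Suc n) m - picard G M A h v (Suc n) m)
      \<le> (1 + ?x) ^ n * ?d + ?x * (1 + ?x) ^ n * ?d"
    unfolding eq by (rule norm_triangle_mono[OF 2 1])
  then show ?case by (simp add: algebra_simps)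
qed simp

text \<open>
  Consecutive increments shrink by the factor \<open>h q L\<close>, because each is \<open>h A\<close> applied to a difference of
  values of \<open>G\<close>. The increment from the \<open>n\<close>-th to the next iterate is also the defect of the \<open>n\<close>-th
  iterate in the stage equations, and its order in \<open>h\<close> is the one in the final error bound.
\<close>

lemma picard_increment:
  fixes G :: "'a::real_normed_vector \<Rightarrow> 'a"
  assumes L: "0 \<le> L"
      "\<And>u v. norm u \<le> R \<Longrightarrow> norm v \<le> R \<Longrightarrow> norm (G u - G v) \<le> L * norm (u - v)"
    and q: "\<And>m. m \<le> M \<Longrightarrow> (\<Sum>j\<le>M. \<bar>A m j\<bar>) \<le> q" "0 \<le> q" and "0 \<le> h"
    and u: "\<And>k m. k \<le> n \<Longrightarrow> m \<le> M \<Longrightarrow> norm (picard G M A h u k m) \<le> R"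
    and g: "norm (G u) \<le> g"
    and "m \<le> M"
  shows "norm (picard G M A h u (Suc n) m - picard G M A h u n m) \<le> h * q * (h * q * L) ^ n * g"
  using u \<open>m \<le> M\<close>
proof (induction n arbitrary: m)
  case 0
  have "0 \<le> g" using g norm_ge_zero order_trans by blast
  then show ?case
    using norm_weighted_sum_le[of M "\<lambda>j. G u" g "A m" q h] g q 0 \<open>0 \<le> h\<close> by simp
next
  case (Suc n)
  let ?F = "\<lambda>j. G (picard G M A h u (Suc n) j) - G (picard G M A h u n j)"
  let ?\<rho> = "h * q * (h * q * L) ^ n * g"
  have "0 \<le> g" using g norm_ge_zero order_trans by blast
  have "norm (?F j) \<le> L * ?\<rho>" if "j \<le> M" for j
  proof -
    have "norm (?F j) \<le> L * norm (picard G M A h u (Suc n) j - picard G M A h u n j)"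
      using Suc.prems that by (intro L(2)) (auto simp del: picard.simps)
    also have "\<dots> \<le> L * ?\<rho>"
      using Suc.prems that L(1) by (intro mult_left_mono Suc.IH) auto
    finally show ?thesis .
  qed
  then have "norm (h *\<^sub>R (\<Sum>j\<le>M. A m j *\<^sub>R ?F j)) \<le> h * q * (L * ?\<rho>)"
    using Suc.prems q L(1) \<open>0 \<le> h\<close> \<open>0 \<le> g\<close> by (intro norm_weighted_sum_le) auto
  moreover have "picard G M A h u (Suc (Suc n)) m - picard G M A h u (Suc n) m
      = h *\<^sub>R (\<Sum>j\<le>M. A m j *\<^sub>R ?F j)"
    by (simp add: algebra_simps sum_subtractf)
  ultimately show ?case by (simp add: algebra_simps del: picard.simps)
qed

section \<open>Algebraic stability\<close>

text \<open>
  Positive semidefiniteness passes from real to vector-valued families, because the quadratic form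
  splits into the ones of the coordinates.
\<close>

lemma positive_semidef_inner:
  fixes F :: "nat \<Rightarrow> 'a::euclidean_space"
  assumes "positive_semidef M A"
  shows "0 \<le> (\<Sum>i\<le>M. \<Sum>j\<le>M. A i j * (F i \<bullet> F j))"
proof -
  have "(\<Sum>i\<le>M. \<Sum>j\<le>M. A i j * (F i \<bullet> F j))
      = (\<Sum>i\<le>M. \<Sum>j\<le>M. \<Sum>e\<in>Basis. (F i \<bullet> e) * A i j * (F j \<bullet> e))"
    by (simp add: euclidean_inner[of "F i" "F j" for i j] sum_distrib_left mult_ac)
  also have "\<dots> = (\<Sum>i\<le>M. \<Sum>e\<in>Basis. \<Sum>j\<le>M. (F i \<bullet> e) * A i j * (F j \<bullet> e))"
    by (intro sum.cong refl sum.swap)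
  also have "\<dots> = (\<Sum>e\<in>Basis. \<Sum>i\<le>M. \<Sum>j\<le>M. (F i \<bullet> e) * A i j * (F j \<bullet> e))"
    by (rule sum.swap)
  also have "\<dots> \<ge> 0"
  proof (rule sum_nonneg)
    fix e :: 'a
    show "0 \<le> (\<Sum>i\<le>M. \<Sum>j\<le>M. (F i \<bullet> e) * A i j * (F j \<bullet> e))"
      using assms unfolding positive_semidef_def by (elim conjE allE[of _ "\<lambda>i. F i \<bullet> e"])
  qed
  finally show ?thesis .
qed

text \<open>
  This is the identity behind B-stability, for two approximate solutions of the stage equations.
  Here \<open>d\<close>, \<open>X\<close>, \<open>F\<close> and \<open>r\<close> are the differences of their initial values, stages, field values and defects.
  On expanding the square, the stage equations turn \<open>d \<bullet> F\<^sub>j\<close> into \<open>X\<^sub>j \<bullet> F\<^sub>j\<close>, which dissipativity makes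
  nonpositive, minus terms quadratic in \<open>F\<close>, which the stability matrix dominates, minus \<open>r\<^sub>j \<bullet> F\<^sub>j\<close>.
\<close>

lemma algebraic_stability_estimate:
  fixes F X r :: "nat \<Rightarrow> 'a::euclidean_space" and d :: 'a
  assumes X: "\<And>j. j \<le> M \<Longrightarrow> X j = d + h *\<^sub>R (\<Sum>k\<le>M. A j k *\<^sub>R F k) + r j"
    and diss: "\<And>j. j \<le> M \<Longrightarrow> F j \<bullet> X j \<le> 0"
    and b: "\<And>j. j \<le> M \<Longrightarrow> 0 \<le> b j"
    and psd: "positive_semidef M (\<lambda>i j. b i * A i j + A j i * b j - b i * b j)"
    and "0 \<le> h"
  shows "(norm (d + h *\<^sub>R (\<Sum>j\<le>M. b j *\<^sub>R F j)))\<^sup>2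
      \<le> (norm d)\<^sup>2 - 2 * h * (\<Sum>j\<le>M. b j * (r j \<bullet> F j))"
proof -
  define S where "S = (\<Sum>j\<le>M. b j *\<^sub>R F j)"
  define E where "E = (\<Sum>i\<le>M. \<Sum>j\<le>M. b i * A i j * (F i \<bullet> F j))"
  have SS: "S \<bullet> S = (\<Sum>i\<le>M. \<Sum>j\<le>M. b i * b j * (F i \<bullet> F j))"
    by (simp add: S_def inner_sum_left inner_sum_right sum_distrib_left mult_ac inner_commute)
  have swap: "(\<Sum>i\<le>M. \<Sum>j\<le>M. A j i * b j * (F i \<bullet> F j)) = E"
    unfolding E_def by (subst sum.swap) (simp add: inner_commute mult_ac)
  have "0 \<le> (\<Sum>i\<le>M. \<Sum>j\<le>M. (b i * A i j + A j i * b j - b i * b j) * (F i \<bullet> F j))"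
    using positive_semidef_inner[OF psd] .
  also have "\<dots> = E + (\<Sum>i\<le>M. \<Sum>j\<le>M. A j i * b j * (F i \<bullet> F j)) - S \<bullet> S"
    by (simp add: SS E_def sum.distrib sum_subtractf distrib_right left_diff_distrib)
  also have "\<dots> = E + E - S \<bullet> S"
    by (simp only: swap)
  finally have quad: "S \<bullet> S \<le> 2 * E" by simp
  have "d \<bullet> S = (\<Sum>j\<le>M. b j * (F j \<bullet> X j - h * (\<Sum>k\<le>M. A j k * (F j \<bullet> F k)) - r j \<bullet> F j))"
    unfolding S_def inner_sum_right inner_scaleR_right
  proof (rule sum.cong[OF refl])
    fix j assume "j \<in> {..M}"
    then have "F j \<bullet> X j = F j \<bullet> d + h * (\<Sum>k\<le>M. A j k * (F j \<bullet> F k)) + r j \<bullet> F j"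
      by (simp add: X inner_add_right inner_sum_right inner_commute)
    then show "b j * (d \<bullet> F j) =
        b j * (F j \<bullet> X j - h * (\<Sum>k\<le>M. A j k * (F j \<bullet> F k)) - r j \<bullet> F j)"
      by (simp add: inner_commute)
  qed
  also have "\<dots> = (\<Sum>j\<le>M. b j * (F j \<bullet> X j)) - h * E - (\<Sum>j\<le>M. b j * (r j \<bullet> F j))"
    by (simp add: E_def algebra_simps sum_subtractf sum.distrib sum_distrib_left)
  also have "\<dots> \<le> - h * E - (\<Sum>j\<le>M. b j * (r j \<bullet> F j))"
    using sum_nonpos[of "{..M}" "\<lambda>j. b j * (F j \<bullet> X j)"] b diss
    by (simp add: mult_nonneg_nonpos)
  finally have dS: "d \<bullet> S \<le> - h * E - (\<Sum>j\<le>M. b j * (r j \<bullet> F j))" .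
  have 1: "2 * h * (d \<bullet> S) \<le> 2 * h * (- h * E - (\<Sum>j\<le>M. b j * (r j \<bullet> F j)))"
    using dS \<open>0 \<le> h\<close> by (intro mult_left_mono) auto
  have 2: "h\<^sup>2 * (S \<bullet> S) \<le> h\<^sup>2 * (2 * E)"
    using quad by (intro mult_left_mono) auto
  have "(norm (d + h *\<^sub>R S))\<^sup>2 = (norm d)\<^sup>2 + 2 * h * (d \<bullet> S) + h\<^sup>2 * (S \<bullet> S)"
    unfolding power2_norm_eq_inner
    by (simp add: inner_add_left inner_add_right inner_commute[of S d] power2_eq_square distrib_left)
  also have "\<dots> \<le> (norm d)\<^sup>2 + 2 * h * (- h * E - (\<Sum>j\<le>M. b j * (r j \<bullet> F j))) + h\<^sup>2 * (2 * E)"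
    using 1 2 by linarith
  also have "\<dots> = (norm d)\<^sup>2 - 2 * h * (\<Sum>j\<le>M. b j * (r j \<bullet> F j))"
    by (simp add: right_diff_distrib power2_eq_square)
  finally show ?thesis by (simp add: S_def)
qed

text \<open>
  The estimate is applied to the \<open>n\<close>-th iterates, whose defects are at most \<open>\<rho> = O(h\<^sup>n\<^sup>+\<^sup>1)\<close>. Its left-hand
  side is then the distance between the iterates that follow at stage \<open>M\<close>. Each of them lies within
  \<open>\<rho>\<close> of the \<open>n\<close>-th iterate, so two more defects are added at the end.
\<close>

lemma picard_almost_nonexpansive:
  fixes G :: "'a::euclidean_space \<Rightarrow> 'a"
  assumes G: "lipschitz_on_balls G"
    and diss: "\<And>u v. (G u - G v) \<bullet> (u - v) \<le> 0"
    and b: "\<And>j. j \<le> M \<Longrightarrow> 0 \<le> A M j"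
    and psd: "positive_semidef M (\<lambda>i j. A M i * A i j + A j i * A M j - A M i * A M j)"
    and "bounded B"
  shows "\<exists>C>0. \<forall>h u v. 0 \<le> h \<longrightarrow> h \<le> T \<longrightarrow> u \<in> B \<longrightarrow> v \<in> B \<longrightarrow>
           norm (picard G M A h u n M - picard G M A h v n M) \<le> norm (u - v) + C * h ^ Suc n"
proof -
  define q where "q = (\<Sum>m\<le>M. \<Sum>j\<le>M. \<bar>A m j\<bar>)"
  have q: "(\<Sum>j\<le>M. \<bar>A m j\<bar>) \<le> q" if "m \<le> M" for m
    unfolding q_def using that
    by (intro member_le_sum[of m "{..M}" "\<lambda>m. \<Sum>j\<le>M. \<bar>A m j\<bar>"]) (auto intro: sum_nonneg)
  have q0: "0 \<le> q" unfolding q_def by (intro sum_nonneg) auto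
  obtain R where R: "R \<ge> 0"
    "\<And>k h u m. k \<le> n \<Longrightarrow> 0 \<le> h \<Longrightarrow> h \<le> T \<Longrightarrow> u \<in> B \<Longrightarrow> m \<le> M \<Longrightarrow> norm (picard G M A h u k m) \<le> R"
    using picard_bounded[OF G \<open>bounded B\<close>, of M A q n T] q q0 by auto
  obtain L where L: "L \<ge> 0"
    "\<And>u v. norm u \<le> R \<Longrightarrow> norm v \<le> R \<Longrightarrow> norm (G u - G v) \<le> L * norm (u - v)"
    using G unfolding lipschitz_on_balls_def by metis
  obtain g where g: "g \<ge> 0" "\<And>u. norm u \<le> R \<Longrightarrow> norm (G u) \<le> g"
    using lipschitz_on_balls_imp_bounded[OF G] by metis
  define \<Lambda> where "\<Lambda> = L * (1 + T * q * L) ^ n"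
  define c where "c = q * (q * L) ^ n * g"
  (* \<Lambda> is a Lipschitz constant of the stage field values in the initial value, and c * h ^ Suc n
     bounds the defect. The summand 1 in C ensures C > 0 when the defect vanishes. *)
  define C where "C = 2 * (T * q * \<Lambda> + 1) * c + 1"
  have c0: "0 \<le> c" using q0 L g by (simp add: c_def)
  have main: "norm (picard G M A h u n M - picard G M A h v n M) \<le> norm (u - v) + C * h ^ Suc n"
    if h: "0 \<le> h" "h \<le> T" and uB: "u \<in> B" and vB: "v \<in> B" for h u v
  proof -
    let ?P = "picard G M A h"
    define d where "d = u - v"
    define X where "X j = ?P u n j - ?P v n j" for j
    define F where "F j = G (?P u n j) - G (?P v n j)" for j
    define r where "r j = (?P u n j - ?P u (Suc n) j) - (?P v n j - ?P v (Suc n) j)" for j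
    define \<rho> where "\<rho> = c * h ^ Suc n"
    have \<rho>0: "0 \<le> \<rho>" using c0 h by (simp add: \<rho>_def)
    have \<Lambda>0: "0 \<le> \<Lambda>" using L q0 h by (auto simp: \<Lambda>_def)
    have defect: "norm (?P w (Suc n) m - ?P w n m) \<le> \<rho>" if "w \<in> B" "m \<le> M" for w m
    proof -
      have "norm w \<le> R" using R(2)[of 0 h w 0] h that by simp
      then have "norm (?P w (Suc n) m - ?P w n m) \<le> h * q * (h * q * L) ^ n * g"
        using L q q0 h R(2) g that by (intro picard_increment[of L R]) auto
      also have "\<dots> = \<rho>"
        by (simp add: \<rho>_def c_def power_mult_distrib mult_ac)
      finally show ?thesis .
    qed
    have r: "norm (r j) \<le> 2 * \<rho>" if "j \<le> M" for j
      unfolding r_def using defect[OF uB that] defect[OF vB that]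
        norm_triangle_ineq4[of "?P u n j - ?P u (Suc n) j" "?P v n j - ?P v (Suc n) j"]
      by (simp only: norm_minus_commute)
    have F: "norm (F j) \<le> \<Lambda> * norm d" if "j \<le> M" for j
    proof -
      have pow: "(1 + h * q * L) ^ n \<le> (1 + T * q * L) ^ n"
        using h q0 L(1) by (intro power_mono add_mono mult_right_mono) auto
      have "norm (X j) \<le> (1 + h * q * L) ^ n * norm d"
        unfolding X_def d_def using L q q0 h R(2) uB vB that
        by (intro picard_lipschitz[of L R]) auto
      also have "\<dots> \<le> (1 + T * q * L) ^ n * norm d"
        using pow by (intro mult_right_mono) auto
      finally have "L * norm (X j) \<le> L * ((1 + T * q * L) ^ n * norm d)"
        using L(1) by (intro mult_left_mono)
      moreover have "norm (F j) \<le> L * norm (X j)"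
        unfolding F_def X_def using R(2) h uB vB that by (intro L(2)) auto
      ultimately show ?thesis
        by (simp add: \<Lambda>_def mult.assoc)
    qed
    have X: "X j = d + h *\<^sub>R (\<Sum>k\<le>M. A j k *\<^sub>R F k) + r j" for j
      by (simp add: X_def d_def F_def r_def algebra_simps sum_subtractf)
    have pairing: "- (\<Sum>j\<le>M. A M j * (r j \<bullet> F j)) \<le> q * (2 * \<rho> * (\<Lambda> * norm d))"
    proof -
      have "- (\<Sum>j\<le>M. A M j * (r j \<bullet> F j)) \<le> (\<Sum>j\<le>M. A M j * (2 * \<rho> * (\<Lambda> * norm d)))"
        unfolding sum_negf[symmetric]
      proof (rule sum_mono)
        fix j assume j: "j \<in> {..M}"
        have "- (r j \<bullet> F j) \<le> norm (r j) * norm (F j)"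
          using norm_cauchy_schwarz[of "- r j" "F j"] by simp
        also have "\<dots> \<le> 2 * \<rho> * (\<Lambda> * norm d)"
          using r F j \<rho>0 by (intro mult_mono) auto
        finally have "A M j * - (r j \<bullet> F j) \<le> A M j * (2 * \<rho> * (\<Lambda> * norm d))"
          using b j by (intro mult_left_mono) auto
        then show "- (A M j * (r j \<bullet> F j)) \<le> A M j * (2 * \<rho> * (\<Lambda> * norm d))"
          by simp
      qed
      also have "\<dots> = (\<Sum>j\<le>M. \<bar>A M j\<bar>) * (2 * \<rho> * (\<Lambda> * norm d))"
        unfolding sum_distrib_right using b by (intro sum.cong) auto
      also have "\<dots> \<le> q * (2 * \<rho> * (\<Lambda> * norm d))"
        using q[of M] \<rho>0 \<Lambda>0 by (intro mult_right_mono) auto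
      finally show ?thesis .
    qed
    have next_iterate: "?P u (Suc n) M - ?P v (Suc n) M = d + h *\<^sub>R (\<Sum>j\<le>M. A M j *\<^sub>R F j)"
      by (simp add: d_def F_def algebra_simps sum_subtractf)
    have "(norm (?P u (Suc n) M - ?P v (Suc n) M))\<^sup>2
        \<le> (norm d)\<^sup>2 - 2 * h * (\<Sum>j\<le>M. A M j * (r j \<bullet> F j))"
      unfolding next_iterate
    proof (rule algebraic_stability_estimate[where X = X and A = A])
      show "F j \<bullet> X j \<le> 0" for j
        unfolding F_def X_def by (rule diss)
    qed (use X b psd h(1) in auto)
    also have "\<dots> \<le> (norm d)\<^sup>2 + 2 * h * (q * (2 * \<rho> * (\<Lambda> * norm d)))"
    proof -
      have "2 * h * - (\<Sum>j\<le>M. A M j * (r j \<bullet> F j)) \<le> 2 * h * (q * (2 * \<rho> * (\<Lambda> * norm d)))"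
        by (rule mult_left_mono[OF pairing]) (use h(1) in simp)
      then show ?thesis by (simp only: mult_minus_right diff_conv_add_uminus add_left_mono)
    qed
    (* The factor norm d in the error term makes it part of a square, so the root costs no order. *)
    also have "\<dots> \<le> (norm d + 2 * h * q * \<Lambda> * \<rho>)\<^sup>2"
      by (simp add: power2_sum mult_ac)
    finally have "norm (?P u (Suc n) M - ?P v (Suc n) M) \<le> norm d + 2 * h * q * \<Lambda> * \<rho>"
      by (rule power2_le_imp_le) (use \<rho>0 \<Lambda>0 q0 h in simp)
    moreover have "X M = (?P u (Suc n) M - ?P v (Suc n) M) + r M"
      by (simp only: X_def r_def) simp
    ultimately have "norm (X M) \<le> norm d + 2 * h * q * \<Lambda> * \<rho> + 2 * \<rho>"
      using r[of M] by (metis norm_triangle_mono order_refl)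
    moreover have "2 * h * q * \<Lambda> * \<rho> \<le> 2 * T * q * \<Lambda> * \<rho>"
      using h q0 \<Lambda>0 \<rho>0 by (intro mult_right_mono) auto
    moreover have "C * h ^ Suc n = 2 * T * q * \<Lambda> * \<rho> + 2 * \<rho> + h ^ Suc n"
      by (simp add: C_def \<rho>_def algebra_simps)
    moreover have "0 \<le> h ^ Suc n"
      using h by simp
    ultimately show ?thesis
      unfolding X_def d_def by linarith
  qed
  show ?thesis
  proof (cases "0 \<le> T")
    case True
    then have "C > 0"
      using q0 L c0 by (auto simp: C_def \<Lambda>_def intro!: add_nonneg_pos mult_nonneg_nonneg)
    then show ?thesis using main by blast
  next
    case False
    then show ?thesis by (intro exI[of _ 1]) auto
  qed
qed

section \<open>Row sums of the quadrature matrix\<close>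

lemma lagrange_basis_at_node:
  assumes "inj_on \<tau> {..M}" "j \<le> M" "k \<le> M"
  shows "lagrange_basis M \<tau> j (\<tau> k) = (if j = k then 1 else 0)"
proof (cases "j = k")
  case True
  have "(\<tau> j - \<tau> i) / (\<tau> j - \<tau> i) = 1" if "i \<in> {..M} - {j}" for i
    using assms that by (auto simp: inj_on_def)
  then show ?thesis
    using True unfolding lagrange_basis_def by simp
next
  case False
  then show ?thesis
    using assms unfolding lagrange_basis_def by auto
qed

text \<open>
  The sum of the Lagrange basis has degree at most \<open>M\<close> and equals \<open>1\<close> at \<open>M + 1\<close> distinct nodes.
\<close>

lemma sum_lagrange_basis:
  assumes inj: "inj_on \<tau> {..M}"
  shows "(\<Sum>j\<le>M. lagrange_basis M \<tau> j x) = 1"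
proof -
  define l where "l j = (\<Prod>i\<in>{..M} - {j}. smult (1 / (\<tau> j - \<tau> i)) [:- \<tau> i, 1:])" for j
  have l: "poly (l j) x = lagrange_basis M \<tau> j x" for j x
    by (auto simp: l_def lagrange_basis_def poly_prod diff_divide_distrib intro!: prod.cong)
  have deg_l: "degree (l j) \<le> M" if "j \<le> M" for j
  proof -
    have "degree (l j) \<le> (\<Sum>i\<in>{..M} - {j}. degree (smult (1 / (\<tau> j - \<tau> i)) [:- \<tau> i, 1:]))"
      unfolding l_def by (rule degree_prod_sum_le[unfolded o_def]) simp
    also have "\<dots> \<le> (\<Sum>i\<in>{..M} - {j}. 1)"
      by (intro sum_mono) (auto simp: degree_smult_eq)
    also have "\<dots> = M"
      using that by simp
    finally show ?thesis .
  qed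
  define p where "p = (\<Sum>j\<le>M. l j) - 1"
  have deg: "degree p \<le> M"
    unfolding p_def by (intro degree_diff_le degree_sum_le deg_l) auto
  have root: "poly p (\<tau> k) = 0" if "k \<le> M" for k
    using that by (simp add: p_def poly_sum l lagrange_basis_at_node[OF inj])
  have "p = 0"
  proof (rule ccontr)
    assume "p \<noteq> 0"
    then have "card (\<tau> ` {..M}) \<le> card {x. poly p x = 0}"
      using root by (intro card_mono poly_roots_finite) auto
    also have "\<dots> \<le> degree p"
      using \<open>p \<noteq> 0\<close> by (rule card_poly_roots_bound)
    finally show False
      using deg by (simp add: card_image[OF inj])
  qed
  then have "poly (\<Sum>j\<le>M. l j) x = 1"
    by (simp add: p_def)
  then show ?thesis
    by (simp add: poly_sum l)
qed

lemma sum_quad_Q: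
  assumes "quadrature_nodes M \<tau>" "m \<le> M"
  shows "(\<Sum>j\<le>M. quad_Q M \<tau> m j) = \<tau> m"
proof -
  have mono: "strict_mono_on {..M} \<tau>" and "0 \<le> \<tau> 0"
    using assms(1) by (auto simp: quadrature_nodes_def)
  have "inj_on \<tau> {..M}"
    using mono by (rule strict_mono_on_imp_inj_on)
  moreover have "0 \<le> \<tau> m"
    using strict_mono_onD[OF mono, of 0 m] \<open>0 \<le> \<tau> 0\<close> assms(2) by (cases "m = 0") auto
  moreover have "lagrange_basis M \<tau> j integrable_on {0..\<tau> m}" for j
    unfolding lagrange_basis_def divide_inverse
    by (intro integrable_continuous_interval continuous_intros)
  ultimately show ?thesis
    unfolding quad_Q_def by (simp add: integral_sum[symmetric] sum_lagrange_basis)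
qed

section \<open>The scheme in logarithmic variables\<close>

lemma Exp_Log_vec: "y \<in> pos_orthant \<Longrightarrow> Exp_vec (Log_vec y) = y"
  by (simp add: Exp_vec_def Log_vec_def pos_orthant_def vec_eq_iff)

lemma Log_Exp_vec: "Log_vec (Exp_vec u) = u"
  by (simp add: Exp_vec_def Log_vec_def vec_eq_iff)

text \<open>
  The index shift comes from the initial stages: since row \<open>m\<close> of \<open>Q\<close> sums to \<open>\<tau>\<^sub>m\<close>, a Picard step from
  the constant stages \<open>u\<close> gives \<open>u + h \<tau>\<^sub>m G(u)\<close>.
\<close>

lemma spidec_stage_eq_Exp_picard:
  assumes nodes: "quadrature_nodes M \<tau>" and y: "y \<in> pos_orthant" and "m \<le> M"
  shows "spidec_stage f M \<tau> h y k m =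
    Exp_vec (picard (log_field f) M (quad_Q M \<tau>) h (Log_vec y) (Suc k) m)"
  using \<open>m \<le> M\<close>
proof (induction k arbitrary: m)
  case 0
  have "(\<Sum>j\<le>M. quad_Q M \<tau> m j *\<^sub>R log_field f (Log_vec y)) = \<tau> m *\<^sub>R log_field f (Log_vec y)"
    using sum_quad_Q[OF nodes 0] by (simp add: scaleR_left.sum[symmetric])
  then show ?case
    using y Exp_Log_vec[OF y]
    by (simp add: vec_eq_iff Exp_vec_def Log_vec_def pos_orthant_def log_field_def exp_add)
next
  case (Suc k)
  have field: "log_field f u $ i = f (Exp_vec u) $ i / Exp_vec u $ i" for u i
    by (simp add: log_field_def Exp_vec_def)
  have "spidec_stage f M \<tau> h y (Suc k) m $ i =
    Exp_vec (picard (log_field f) M (quad_Q M \<tau>) h (Log_vec y) (Suc (Suc k)) m) $ i" for i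
  proof -
    have "spidec_stage f M \<tau> h y (Suc k) m $ i = y $ i * exp (h * (\<Sum>j\<le>M. quad_Q M \<tau> m j *
        log_field f (picard (log_field f) M (quad_Q M \<tau>) h (Log_vec y) (Suc k) j) $ i))"
      by (simp add: Suc.IH field del: picard.simps)
    also have "\<dots> = Exp_vec (picard (log_field f) M (quad_Q M \<tau>) h (Log_vec y) (Suc (Suc k)) m) $ i"
      unfolding picard.simps(2)[of _ _ _ _ _ "Suc k"] Exp_vec_def
      using y by (simp add: Log_vec_def pos_orthant_def exp_add del: picard.simps)
    finally show ?thesis .
  qed
  then show ?case by (simp add: vec_eq_iff)
qed

lemma Log_spidec_stage:
  assumes "quadrature_nodes M \<tau>" "y \<in> pos_orthant" "m \<le> M"
  shows "Log_vec (spidec_stage f M \<tau> h y k m) =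
    picard (log_field f) M (quad_Q M \<tau>) h (Log_vec y) (Suc k) m"
  using spidec_stage_eq_Exp_picard[OF assms] by (simp add: Log_Exp_vec)

lemma bounded_Log_image:
  assumes "compact K" "K \<subseteq> pos_orthant"
  shows "bounded (Log_vec ` K)"
proof -
  have "x $ i \<noteq> 0" if "x \<in> K" for x i
    using assms(2) that less_imp_neq[of 0 "x $ i"] by (auto simp: pos_orthant_def subset_iff)
  then have "continuous_on K Log_vec"
    unfolding Log_vec_def by (intro continuous_intros) auto
  then show ?thesis
    using assms(1) by (intro compact_imp_bounded compact_continuous_image)
qed

lemma abs_exp_diff_le:
  fixes a b :: real
  assumes "a \<le> R" "b \<le> R"
  shows "\<bar>exp a - exp b\<bar> \<le> exp R * \<bar>a - b\<bar>"
proof -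
  have "norm (exp a - exp b) \<le> exp R * norm (a - b)"
  proof (rule field_differentiable_bound[of "{..R}" exp exp])
    show "(exp has_field_derivative exp x) (at x within {..R})" for x :: real
      by (intro DERIV_subset[OF DERIV_exp]) auto
  qed (use assms in auto)
  then show ?thesis by simp
qed

text \<open>
  The exponential maps a ball into a box inside the orthant. The box is compact and convex, so \<open>f\<close>,
  being continuously differentiable, is Lipschitz on it. The estimate for the quotient is then that
  of the product of \<open>f\<close> and \<open>exp (- u\<^sub>i)\<close>.
\<close>

lemma log_field_lipschitz_on_balls:
  fixes f :: "real ^ 'n \<Rightarrow> real ^ 'n"
  assumes "pos_orthant \<subseteq> D" "C1_on f D"
  shows "lipschitz_on_balls (log_field f)"
  unfolding lipschitz_on_balls_def
proof
  fix R :: real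
  define box :: "(real ^ 'n) set" where "box = cbox (\<chi> i. exp (- R)) (\<chi> i. exp R)"
  have box: "Exp_vec u \<in> box" if "norm u \<le> R" for u
  proof -
    have "\<bar>u $ i\<bar> \<le> R" for i
      using component_le_norm_cart[of u i] that by linarith
    then show ?thesis
      by (auto simp: box_def mem_box_cart Exp_vec_def abs_le_iff minus_le_iff)
  qed
  have "box \<subseteq> pos_orthant"
    unfolding box_def pos_orthant_def
    by (auto simp: mem_box_cart) (meson exp_gt_zero less_le_trans)
  then have "box \<subseteq> D" using assms(1) by blast
  obtain f' where f': "\<And>x. x \<in> D \<Longrightarrow> (f has_derivative blinfun_apply (f' x)) (at x)"
    and "continuous_on D f'"
    using assms(2) unfolding C1_on_def by blast
  have cpt: "compact box" "convex box"
    by (auto simp: box_def)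
  have "continuous_on box f'"
    using \<open>continuous_on D f'\<close> \<open>box \<subseteq> D\<close> continuous_on_subset by blast
  then have "bounded (f' ` box)"
    using cpt(1) by (intro compact_imp_bounded compact_continuous_image)
  then obtain \<beta> where \<beta>: "\<beta> > 0" "\<And>x. x \<in> box \<Longrightarrow> norm (f' x) \<le> \<beta>"
    unfolding bounded_pos by blast
  have "continuous_on box f"
    using f' \<open>box \<subseteq> D\<close> by (meson continuous_at_imp_continuous_on has_derivative_continuous subsetD)
  then have "bounded (f ` box)"
    using cpt(1) by (intro compact_imp_bounded compact_continuous_image)
  then obtain \<gamma> where \<gamma>: "\<gamma> > 0" "\<And>x. x \<in> box \<Longrightarrow> norm (f x) \<le> \<gamma>"
    unfolding bounded_pos by blast
  have lip_f: "norm (f x - f z) \<le> \<beta> * norm (x - z)" if "x \<in> box" "z \<in> box" for x z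
  proof (rule differentiable_bound[OF cpt(2) _ _ that(1) that(2)])
    show "(f has_derivative blinfun_apply (f' w)) (at w within box)" if "w \<in> box" for w
      using f' \<open>box \<subseteq> D\<close> that has_derivative_at_withinI by blast
    show "onorm (blinfun_apply (f' w)) \<le> \<beta>" if "w \<in> box" for w
      using \<beta>(2)[OF that] by (simp add: norm_blinfun.rep_eq)
  qed
  let ?N = "real CARD('n)" and ?e = "exp R"
  have Exp: "norm (Exp_vec u - Exp_vec v) \<le> ?N * (?e * norm (u - v))"
    if "norm u \<le> R" "norm v \<le> R" for u v :: "real ^ 'n"
  proof -
    have "\<bar>(Exp_vec u - Exp_vec v) $ i\<bar> \<le> ?e * norm (u - v)" for i
    proof -
      have "\<bar>exp (u $ i) - exp (v $ i)\<bar> \<le> ?e * \<bar>u $ i - v $ i\<bar>"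
        using component_le_norm_cart[of u i] component_le_norm_cart[of v i] that
        by (intro abs_exp_diff_le) auto
      also have "\<dots> \<le> ?e * norm (u - v)"
        using component_le_norm_cart[of "u - v" i] by simp
      finally show ?thesis by (simp add: Exp_vec_def)
    qed
    then have "(\<Sum>i\<in>UNIV. \<bar>(Exp_vec u - Exp_vec v) $ i\<bar>) \<le> ?N * (?e * norm (u - v))"
      using sum_bounded_above[of UNIV "\<lambda>i. \<bar>(Exp_vec u - Exp_vec v) $ i\<bar>"] by simp
    then show ?thesis
      using norm_le_l1_cart order_trans by blast
  qed
  define \<kappa> where "\<kappa> = ?e * (\<beta> * (?N * ?e)) + \<gamma> * ?e"
  have "norm (log_field f u - log_field f v) \<le> (?N * \<kappa>) * norm (u - v)"
    if uv: "norm u \<le> R" "norm v \<le> R" for u v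
  proof -
    have "\<bar>(log_field f u - log_field f v) $ i\<bar> \<le> \<kappa> * norm (u - v)" for i
    proof -
      let ?a = "f (Exp_vec u) $ i" and ?c = "f (Exp_vec v) $ i"
      have ui: "\<bar>u $ i\<bar> \<le> R" "\<bar>v $ i\<bar> \<le> R"
        using component_le_norm_cart[of u i] component_le_norm_cart[of v i] uv by linarith+
      have "\<bar>?a - ?c\<bar> \<le> norm (f (Exp_vec u) - f (Exp_vec v))"
        using component_le_norm_cart[of "f (Exp_vec u) - f (Exp_vec v)" i] by simp
      also have "\<dots> \<le> \<beta> * norm (Exp_vec u - Exp_vec v)"
        using box uv by (intro lip_f) auto
      also have "\<dots> \<le> \<beta> * (?N * (?e * norm (u - v)))"
        using \<beta>(1) Exp[OF uv] by (intro mult_left_mono) auto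
      finally have 1: "\<bar>?a - ?c\<bar> \<le> \<beta> * (?N * (?e * norm (u - v)))" .
      have "\<bar>exp (- u $ i) - exp (- v $ i)\<bar> \<le> ?e * \<bar>- u $ i - - v $ i\<bar>"
        using ui by (intro abs_exp_diff_le) auto
      also have "\<dots> \<le> ?e * norm (u - v)"
        using component_le_norm_cart[of "u - v" i] by simp
      finally have 2: "\<bar>exp (- u $ i) - exp (- v $ i)\<bar> \<le> ?e * norm (u - v)" .
      have 3: "\<bar>?c\<bar> \<le> \<gamma>"
        using component_le_norm_cart[of "f (Exp_vec v)" i] \<gamma>(2)[OF box[OF uv(2)]] by linarith
      have "(log_field f u - log_field f v) $ i
          = exp (- u $ i) * (?a - ?c) + ?c * (exp (- u $ i) - exp (- v $ i))"
        by (simp add: log_field_def exp_minus field_simps)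
      then have "\<bar>(log_field f u - log_field f v) $ i\<bar>
          \<le> exp (- u $ i) * \<bar>?a - ?c\<bar> + \<bar>?c\<bar> * \<bar>exp (- u $ i) - exp (- v $ i)\<bar>"
        by (metis abs_exp_cancel abs_mult abs_triangle_ineq)
      also have "\<dots> \<le> ?e * (\<beta> * (?N * (?e * norm (u - v)))) + \<gamma> * (?e * norm (u - v))"
        using 1 2 3 ui \<gamma>(1) by (intro add_mono mult_mono) auto
      finally show ?thesis by (simp add: \<kappa>_def algebra_simps)
    qed
    then have "(\<Sum>i\<in>UNIV. \<bar>(log_field f u - log_field f v) $ i\<bar>) \<le> ?N * (\<kappa> * norm (u - v))"
      using sum_bounded_above[of UNIV "\<lambda>i. \<bar>(log_field f u - log_field f v) $ i\<bar>"] by simp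
    then show ?thesis
      using norm_le_l1_cart[of "log_field f u - log_field f v"] by simp
  qed
  moreover have "0 \<le> ?N * \<kappa>"
    using \<beta>(1) \<gamma>(1) by (simp add: \<kappa>_def)
  ultimately show "\<exists>L\<ge>0. \<forall>u v. norm u \<le> R \<longrightarrow> norm v \<le> R \<longrightarrow>
      norm (log_field f u - log_field f v) \<le> L * norm (u - v)"
    by blast
qed

section \<open>Contractivity up to the iteration error\<close>

theorem theorem5p7:
  fixes f :: "real ^ 'n \<Rightarrow> real ^ 'n"
    and D K :: "(real ^ 'n) set"
    and \<tau> :: "nat \<Rightarrow> real"
    and M Nk :: nat
    and \<nu> T :: real
  assumes "open D" and "pos_orthant \<subseteq> D" and "C1_on f D"
    and "forward_invariant f D pos_orthant"
    and "quadrature_nodes M \<tau>"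
    and "globally_uniquely_solvable f M \<tau>"
    and "log_dissipative f \<nu>" and "\<nu> \<le> 0"
    and "algebraically_stable M \<tau>"
    and "Nk \<le> M"
    and "0 < T"
    and "compact K" and "K \<subseteq> pos_orthant"
  shows "\<exists>C>0. \<forall>h. 0 < h \<and> h \<le> T \<longrightarrow>
    (\<forall>y\<in>K. \<forall>z\<in>K.
      log_euclidean_dist (spidec_map f M \<tau> Nk h y) (spidec_map f M \<tau> Nk h z)
        \<le> log_euclidean_dist y z + C * h ^ (Nk + 2))"
proof -
  have diss: "(log_field f u - log_field f v) \<bullet> (u - v) \<le> 0" for u v
  proof (rule order_trans)
    show "(log_field f u - log_field f v) \<bullet> (u - v) \<le> \<nu> * (norm (u - v))\<^sup>2"
      using \<open>log_dissipative f \<nu>\<close> by (simp add: log_dissipative_def)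
    show "\<nu> * (norm (u - v))\<^sup>2 \<le> 0"
      using \<open>\<nu> \<le> 0\<close> by (intro mult_nonpos_nonneg) auto
  qed
  have "0 \<le> quad_Q M \<tau> M j" if "j \<le> M" for j
    using \<open>algebraically_stable M \<tau>\<close> that by (simp add: algebraically_stable_def quad_b_def)
  moreover have "positive_semidef M (\<lambda>i j. quad_Q M \<tau> M i * quad_Q M \<tau> i j
      + quad_Q M \<tau> j i * quad_Q M \<tau> M j - quad_Q M \<tau> M i * quad_Q M \<tau> M j)"
    using \<open>algebraically_stable M \<tau>\<close> by (simp add: algebraically_stable_def quad_b_def)
  ultimately obtain C where "C > 0" and C:
    "\<And>h u v. 0 \<le> h \<Longrightarrow> h \<le> T \<Longrightarrow> u \<in> Log_vec ` K \<Longrightarrow> v \<in> Log_vec ` K \<Longrightarrow>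
       norm (picard (log_field f) M (quad_Q M \<tau>) h u (Suc Nk) M
             - picard (log_field f) M (quad_Q M \<tau>) h v (Suc Nk) M)
         \<le> norm (u - v) + C * h ^ Suc (Suc Nk)"
    using picard_almost_nonexpansive[OF log_field_lipschitz_on_balls[OF assms(2,3)] diss _ _
        bounded_Log_image[OF \<open>compact K\<close> \<open>K \<subseteq> pos_orthant\<close>], of M "quad_Q M \<tau>" T "Suc Nk"]
    by blast
  have "log_euclidean_dist (spidec_map f M \<tau> Nk h y) (spidec_map f M \<tau> Nk h z)
        \<le> log_euclidean_dist y z + C * h ^ (Nk + 2)"
    if "0 < h" "h \<le> T" "y \<in> K" "z \<in> K" for h y z
  proof -
    have "y \<in> pos_orthant" "z \<in> pos_orthant"
      using that \<open>K \<subseteq> pos_orthant\<close> by auto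
    then show ?thesis
      using C[of h "Log_vec y" "Log_vec z"] that
      by (simp add: log_euclidean_dist_def spidec_map_def Log_spidec_stage[OF \<open>quadrature_nodes M \<tau>\<close>]
          del: picard.simps spidec_stage.simps)
  qed
  then show ?thesis
    using \<open>C > 0\<close> by blast
qed

end
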